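(* Let $A,B\in\mathcal{B}(\mathcal{H})$ be hyponormal operators. If $BA^*=A^*B$, then $AB$ and $BA$ are $k$-quasihyponormal for every positive integer $k$.
   Context: $\mathcal{H}$ is a complex Hilbert space and $\mathcal{B}(\mathcal{H})$ is the set of bounded linear operators on $\mathcal{H}$. An operator $T\in\mathcal{B}(\mathcal{H})$ is hyponormal if $T^*T\geq TT^*$. For a positive integer $k$, $T\in\mathcal{B}(\mathcal{H})$ is $k$-quasihyponormal if $T^{*k}(T^*T-TT^* )T^k\geq 0$, equivalently $\|T^*T^kx\|\leq\|T^{k+1}x\|$ for all $x\in\mathcal{H}$. *)

theory Defs
  imports "HOL-Analysis.Analysis"
begin

text \<open>
  Complex Hilbert spaces, as complete real inner product spaces with a compatible complex
  structure. The inner product \<open>cinner\<close> is linear in the first argument. The underlying real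
  inner product is its real part, so the norm, metric and topology of the library classes are those
  induced by \<open>cinner\<close>. Every complex Hilbert space arises in this way.
\<close>

class chilbert_space = real_inner + complete_space +
  fixes scaleC :: "complex \<Rightarrow> 'a \<Rightarrow> 'a" (infixr \<open>*\<^sub>C\<close> 75)
    and cinner :: "'a \<Rightarrow> 'a \<Rightarrow> complex"
  assumes scaleC_add_right: "c *\<^sub>C (x + y) = c *\<^sub>C x + c *\<^sub>C y"
    and scaleC_add_left: "(c + d) *\<^sub>C x = c *\<^sub>C x + d *\<^sub>C x"
    and scaleC_scaleC: "c *\<^sub>C d *\<^sub>C x = (c * d) *\<^sub>C x"
    and scaleC_one: "1 *\<^sub>C x = x"
    and scaleR_scaleC: "r *\<^sub>R x = complex_of_real r *\<^sub>C x"
    and cinner_add_left: "cinner (x + y) z = cinner x z + cinner y z"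
    and cinner_scaleC_left: "cinner (c *\<^sub>C x) y = c * cinner x y"
    and cinner_commute: "cinner x y = cnj (cinner y x)"
    and inner_eq_Re_cinner: "inner x y = Re (cinner x y)"

instantiation complex :: chilbert_space
begin

definition scaleC_complex :: "complex \<Rightarrow> complex \<Rightarrow> complex"
  where "scaleC_complex c x = c * x"

definition cinner_complex :: "complex \<Rightarrow> complex \<Rightarrow> complex"
  where "cinner_complex x y = x * cnj y"

instance
  by standard
    (auto simp: scaleC_complex_def cinner_complex_def algebra_simps scaleR_conv_of_real
      inner_complex_def)

end

text \<open>
  Membership in $\mathcal{B}(\mathcal{H})$. The library's \<open>bounded_linear\<close> only asks for
  real-linearity.
\<close>

definition bounded_clinear :: "('h::chilbert_space \<Rightarrow> 'h) \<Rightarrow> bool"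
  where "bounded_clinear T \<longleftrightarrow> bounded_linear T \<and> (\<forall>c x. T (c *\<^sub>C x) = c *\<^sub>C T x)"

text \<open>Meaningful for bounded operators only: see \<open>cadjoint_works\<close> below.\<close>

definition cadjoint :: "('h::chilbert_space \<Rightarrow> 'h) \<Rightarrow> 'h \<Rightarrow> 'h"
  where "cadjoint T = (THE S. \<forall>x y. cinner (T x) y = cinner x (S y))"

definition positive_op :: "('h::chilbert_space \<Rightarrow> 'h) \<Rightarrow> bool"
  where "positive_op T \<longleftrightarrow> (\<forall>x. cinner (T x) x \<in> \<real> \<and> 0 \<le> Re (cinner (T x) x))"

definition hyponormal :: "('h::chilbert_space \<Rightarrow> 'h) \<Rightarrow> bool"
  where "hyponormal T \<longleftrightarrow> bounded_clinear T \<and>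
    positive_op (\<lambda>x. (cadjoint T \<circ> T) x - (T \<circ> cadjoint T) x)"

definition k_quasihyponormal :: "nat \<Rightarrow> ('h::chilbert_space \<Rightarrow> 'h) \<Rightarrow> bool"
  where "k_quasihyponormal k T \<longleftrightarrow> bounded_clinear T \<and>
    positive_op
      ((cadjoint T ^^ k) \<circ> (\<lambda>x. (cadjoint T \<circ> T) x - (T \<circ> cadjoint T) x) \<circ> (T ^^ k))"

text \<open>
  Existence of adjoints. The Riesz representative of \<open>f\<close> is the minimiser of
  \<open>norm x ^ 2 - 2 * f x\<close>.
\<close>

lemma riesz_real:
  fixes f :: "'h::{real_inner,complete_space} \<Rightarrow> real"
  assumes "bounded_linear f"
  shows "\<exists>y. \<forall>x. f x = inner x y"
proof -
  interpret f: bounded_linear f by fact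
  define \<phi> where "\<phi> x = (norm x)\<^sup>2 - 2 * f x" for x
  obtain K where K: "\<And>x. norm (f x) \<le> norm x * K" using f.bounded by blast
  have lb: "- (K\<^sup>2) \<le> \<phi> x" for x
  proof -
    have "f x \<le> norm x * K" using K[of x] by auto
    moreover have "0 \<le> (norm x - K)\<^sup>2" by simp
    ultimately show ?thesis by (simp add: \<phi>_def power2_diff)
  qed
  define m where "m = Inf (range \<phi>)"
  have bdd: "bdd_below (range \<phi>)" using lb by (auto intro!: bdd_belowI)
  have m: "m \<le> \<phi> x" for x unfolding m_def by (rule cInf_lower[OF _ bdd]) auto
  have "\<exists>x. \<phi> x < m + inverse (Suc n)" for n
  proof -
    have "Inf (range \<phi>) < m + inverse (Suc n)" by (simp add: m_def)
    then show ?thesis using cInf_lessD[of "range \<phi>"] by blast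
  qed
  then obtain X where X: "\<And>n. \<phi> (X n) < m + inverse (Suc n)" by metis
  have par: "(norm (x - y))\<^sup>2 = 2 * \<phi> x + 2 * \<phi> y - 4 * \<phi> ((1/2) *\<^sub>R (x + y))" for x y
    by (simp add: \<phi>_def power2_norm_eq_inner f.add f.scaleR inner_simps inner_commute
        algebra_simps)
  have close: "(norm (X n - X p))\<^sup>2 \<le> 2 * inverse (Suc n) + 2 * inverse (Suc p)" for n p
    using par[of "X n" "X p"] X[of n] X[of p] m[of "(1/2) *\<^sub>R (X n + X p)"] by linarith
  have "Cauchy X"
  proof (rule CauchyI)
    fix e :: real assume "0 < e"
    then obtain N where N: "inverse (real (Suc N)) < e\<^sup>2 / 4"
      using reals_Archimedean[of "e\<^sup>2 / 4"] by auto
    have "norm (X n - X p) < e" if "N \<le> n" "N \<le> p" for n p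
    proof -
      have "inverse (real (Suc n)) \<le> inverse (real (Suc N))"
        "inverse (real (Suc p)) \<le> inverse (real (Suc N))"
        using that by (simp_all add: le_imp_inverse_le)
      then have "(norm (X n - X p))\<^sup>2 < e\<^sup>2" using close[of n p] N by linarith
      then show ?thesis using \<open>0 < e\<close> by (simp add: power_less_imp_less_base)
    qed
    then show "\<exists>M. \<forall>n\<ge>M. \<forall>p\<ge>M. norm (X n - X p) < e" by blast
  qed
  then obtain y where y: "X \<longlonglongrightarrow> y" by (auto simp: Cauchy_convergent_iff convergent_def)
  have "(\<lambda>n. \<phi> (X n)) \<longlonglongrightarrow> \<phi> y"
    unfolding \<phi>_def by (intro tendsto_intros y f.tendsto)
  moreover have "(\<lambda>n. m + inverse (real (Suc n))) \<longlonglongrightarrow> m + 0"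
    by (intro tendsto_intros LIMSEQ_inverse_real_of_nat)
  ultimately have "\<phi> y \<le> m + 0"
    by (rule LIMSEQ_le) (use X less_imp_le in blast)
  then have min: "\<phi> y \<le> \<phi> x" for x using m[of x] by simp
  have "f x = inner x y" for x
  proof -
    define d where "d = f x - inner x y"
    have ineq: "2 * t * d \<le> t\<^sup>2 * (norm x)\<^sup>2" for t
    proof -
      have "\<phi> (y + t *\<^sub>R x) = \<phi> y + t\<^sup>2 * (norm x)\<^sup>2 - 2 * t * d"
        unfolding \<phi>_def d_def power2_norm_eq_inner f.add f.scaleR
        by (simp add: inner_simps inner_commute algebra_simps power2_eq_square)
      then show ?thesis using min[of "y + t *\<^sub>R x"] by linarith
    qed
    define N where "N = (norm x)\<^sup>2 + 1"
    have N: "0 < N" "(norm x)\<^sup>2 \<le> N" by (auto simp: N_def add_nonneg_pos)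
    have "2 * (d / N) * d \<le> (d / N)\<^sup>2 * N"
      using ineq[of "d / N"] N(2) mult_left_mono[of "(norm x)\<^sup>2" N "(d / N)\<^sup>2"] by simp
    then have "2 * d\<^sup>2 / N \<le> d\<^sup>2 / N" using N(1) by (simp add: power2_eq_square)
    then have "d\<^sup>2 \<le> 0" using N(1) by (simp add: divide_le_cancel)
    then show ?thesis by (simp add: d_def)
  qed
  then show ?thesis by blast
qed

lemma cadjoint_works:
  assumes "bounded_clinear T"
  shows "cinner (T x) y = cinner x (cadjoint T y)"
proof -
  have T: "bounded_linear T" "\<And>c x. T (c *\<^sub>C x) = c *\<^sub>C T x"
    using assms by (auto simp: bounded_clinear_def)
  have "\<exists>z. \<forall>x. inner (T x) y = inner x z" for y
    by (rule riesz_real) (rule bounded_linear_inner_left_comp[OF T(1)])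
  then obtain S where S: "\<And>x y. inner (T x) y = inner x (S y)" by metis
  have Re: "Re (cinner (T x) y) = Re (cinner x (S y))" for x y
    using S[of x y] by (simp add: inner_eq_Re_cinner)
  have eq: "cinner (T x) y = cinner x (S y)" for x y
    using Re[of x y] Re[of "\<i> *\<^sub>C x" y] by (simp add: complex_eq_iff T(2) cinner_scaleC_left)
  have "\<exists>!S. \<forall>x y. cinner (T x) y = cinner x (S y)"
  proof (rule ex1I[of _ S])
    fix R assume R: "\<forall>x y. cinner (T x) y = cinner x (R y)"
    have "R y = S y" for y
    proof (rule inner_eq_zero_iff[of "R y - S y", THEN iffD1, unfolded right_minus_eq])
      have "inner z (R y) = inner z (S y)" for z using R eq by (metis inner_eq_Re_cinner)
      then show "inner (R y - S y) (R y - S y) = 0" by (simp add: inner_diff_right)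
    qed
    then show "R = S" by blast
  qed (use eq in blast)
  from theI'[OF this] show ?thesis unfolding cadjoint_def by blast
qed

end

theory Submission
  imports Defs
begin

text \<open>
  Hyponormality of \<open>T\<close> says that \<open>\<parallel>T\<^sup>*x\<parallel> \<le> \<parallel>Tx\<parallel>\<close> for every \<open>x\<close>. Under the commutation
  hypothesis \<open>BA\<^sup>* = A\<^sup>*B\<close> this inequality passes to the product: using it for \<open>B\<close> at \<open>A\<^sup>*x\<close> and
  then for \<open>A\<close> at \<open>Bx\<close>,
  \[ \|(AB)^* x\| = \|B^* A^* x\| \le \|B A^* x\| = \|A^* B x\| \le \|A B x\|, \]
  so \<open>AB\<close> is itself hyponormal (\<open>hyponormal_comp\<close>). Taking adjoints turns the hypothesis into
  \<open>AB\<^sup>* = B\<^sup>*A\<close>, which is the same hypothesis with the roles of \<open>A\<close> and \<open>B\<close> exchanged, so \<open>BA\<close>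
  is hyponormal too. Finally, a hyponormal operator is \<open>k\<close>-quasihyponormal for every \<open>k\<close>, since
  compressing a positive operator \<open>P\<close> to \<open>T\<^sup>*\<^sup>kPT\<^sup>k\<close> keeps it positive
  (\<open>hyponormal_imp_k_quasihyponormal\<close>).
\<close>

lemma cinner_self: "cinner x x = complex_of_real ((norm x)\<^sup>2)"
proof (rule complex_eqI)
  show "Re (cinner x x) = Re (complex_of_real ((norm x)\<^sup>2))"
    by (simp add: inner_eq_Re_cinner[symmetric] power2_norm_eq_inner)
  have "Im (cinner x x) = - Im (cinner x x)"
    using arg_cong[OF cinner_commute[of x x], of Im] by simp
  then show "Im (cinner x x) = Im (complex_of_real ((norm x)\<^sup>2))" by simp
qed

lemma cinner_diff_left: "cinner (x - y) z = cinner x z - cinner y z"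
  by (metis cinner_add_left diff_add_cancel eq_diff_eq)

lemma cinner_cadjoint_left:
  assumes "bounded_clinear T"
  shows "cinner (cadjoint T x) y = cinner x (T y)"
  by (metis assms cadjoint_works cinner_commute)

lemma cinner_ext:
  assumes "\<And>z. cinner z x = cinner z y"
  shows "x = y"
proof -
  have "inner z x = inner z y" for z
    by (simp add: inner_eq_Re_cinner assms)
  then show ?thesis by (metis vector_eq_rdot inner_commute)
qed

lemma bounded_clinear_comp:
  assumes "bounded_clinear A" and "bounded_clinear B"
  shows "bounded_clinear (A \<circ> B)"
  using assms bounded_linear_compose[of A B] by (auto simp: bounded_clinear_def comp_def)

lemma cadjoint_comp:
  assumes "bounded_clinear A" and "bounded_clinear B"
  shows "cadjoint (A \<circ> B) = cadjoint B \<circ> cadjoint A"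
proof
  fix y
  show "cadjoint (A \<circ> B) y = (cadjoint B \<circ> cadjoint A) y"
    by (rule cinner_ext)
      (simp add: cadjoint_works[OF bounded_clinear_comp[OF assms], symmetric]
        cadjoint_works[OF assms(1), symmetric] cadjoint_works[OF assms(2), symmetric])
qed

lemma cinner_funpow_cadjoint_left:
  assumes "bounded_clinear T"
  shows "cinner ((cadjoint T ^^ k) x) y = cinner x ((T ^^ k) y)"
proof (induction k arbitrary: y)
  case (Suc k)
  then show ?case
    by (simp add: cinner_cadjoint_left[OF assms] funpow_swap1[of T])
qed simp

lemma cinner_self_commutator:
  assumes "bounded_clinear T"
  shows "cinner ((cadjoint T \<circ> T) x - (T \<circ> cadjoint T) x) x
    = complex_of_real ((norm (T x))\<^sup>2 - (norm (cadjoint T x))\<^sup>2)"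
  by (simp add: cinner_diff_left cinner_cadjoint_left[OF assms] cadjoint_works[OF assms] cinner_self)

lemma hyponormal_iff_norm_cadjoint_le:
  "hyponormal T \<longleftrightarrow> bounded_clinear T \<and> (\<forall>x. norm (cadjoint T x) \<le> norm (T x))"
  by (auto simp: hyponormal_def positive_op_def cinner_self_commutator[simplified])

lemma cadjoint_commute_swap:
  assumes "bounded_clinear A" and "bounded_clinear B"
    and "B \<circ> cadjoint A = cadjoint A \<circ> B"
  shows "A \<circ> cadjoint B = cadjoint B \<circ> A"
proof
  fix y
  have "cinner z (A (cadjoint B y)) = cinner z (cadjoint B (A y))" for z
  proof -
    have "cinner z (A (cadjoint B y)) = cinner (B (cadjoint A z)) y"
      by (simp add: cinner_cadjoint_left[OF assms(1)] cadjoint_works[OF assms(2)])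
    also have "\<dots> = cinner (cadjoint A (B z)) y"
      using fun_cong[OF assms(3), of z] by simp
    also have "\<dots> = cinner z (cadjoint B (A y))"
      by (simp add: cinner_cadjoint_left[OF assms(1)] cadjoint_works[OF assms(2)])
    finally show ?thesis .
  qed
  then show "(A \<circ> cadjoint B) y = (cadjoint B \<circ> A) y" by (simp add: cinner_ext)
qed

text \<open>
  The commutation relation is what lets the two norm inequalities be chained: it moves \<open>A\<^sup>*\<close> past
  \<open>B\<close>, so that it meets the vector \<open>B x\<close> and hyponormality of \<open>A\<close> applies.
\<close>

lemma hyponormal_comp:
  assumes "hyponormal A" and "hyponormal B"
    and "B \<circ> cadjoint A = cadjoint A \<circ> B"
  shows "hyponormal (A \<circ> B)"
proof -
  have lin: "bounded_clinear A" "bounded_clinear B"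
    and le: "\<And>x. norm (cadjoint A x) \<le> norm (A x)" "\<And>x. norm (cadjoint B x) \<le> norm (B x)"
    using assms(1,2) by (auto simp: hyponormal_iff_norm_cadjoint_le)
  have "norm (cadjoint (A \<circ> B) x) \<le> norm ((A \<circ> B) x)" for x
  proof -
    have "norm (cadjoint (A \<circ> B) x) = norm (cadjoint B (cadjoint A x))"
      by (simp add: cadjoint_comp[OF lin])
    also have "\<dots> \<le> norm (B (cadjoint A x))" by (rule le)
    also have "\<dots> = norm (cadjoint A (B x))" using fun_cong[OF assms(3), of x] by simp
    also have "\<dots> \<le> norm (A (B x))" by (rule le)
    finally show ?thesis by simp
  qed
  then show ?thesis by (simp add: hyponormal_iff_norm_cadjoint_le bounded_clinear_comp[OF lin])
qed

text \<open>
  Moving \<open>T\<^sup>*\<^sup>k\<close> across the inner product leaves the quadratic form of \<open>T\<^sup>*T - TT\<^sup>*\<close> evaluated at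
  \<open>T\<^sup>kx\<close>.
\<close>

lemma hyponormal_imp_k_quasihyponormal:
  assumes "hyponormal T"
  shows "k_quasihyponormal k T"
  using assms
  by (auto simp: hyponormal_def k_quasihyponormal_def positive_op_def cinner_funpow_cadjoint_left)

theorem proposition2p2:
  fixes A B :: "'h::chilbert_space \<Rightarrow> 'h"
  assumes "hyponormal A" and "hyponormal B"
    and "B \<circ> cadjoint A = cadjoint A \<circ> B"
  shows "\<forall>k::nat. k \<ge> 1 \<longrightarrow> k_quasihyponormal k (A \<circ> B) \<and> k_quasihyponormal k (B \<circ> A)"
proof -
  have "bounded_clinear A" "bounded_clinear B"
    using assms(1,2) by (auto simp: hyponormal_def)
  then have "A \<circ> cadjoint B = cadjoint B \<circ> A"
    using assms(3) by (rule cadjoint_commute_swap)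
  then have "hyponormal (A \<circ> B)" "hyponormal (B \<circ> A)"
    using assms by (auto intro: hyponormal_comp)
  then show ?thesis by (simp add: hyponormal_imp_k_quasihyponormal)
qed

end
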